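(* For every $n \geq 1$, $|\{\sigma \in \mathfrak{S}_n : \mathbf{S}(\mathbf{S}(\sigma)) = 12\cdots n\}| = |\{\sigma \in \mathfrak{S}_n : \mathbf{S}(\mathbf{r}(\mathbf{S}(\sigma))) = 12\cdots n\}|$. Moreover, for every $n\ge 1$, the $15$-tuple of statistics $(\mathrm{des},\mathrm{maj},\mathrm{rmax},\mathrm{lmax},\mathrm{valley},\mathrm{peak},\mathrm{ddes},\mathrm{dasc},\mathrm{zeil},\mathrm{indmax},\mathrm{rir},\mathrm{rdr},\mathrm{lir},\mathrm{ldr},\mathrm{slmax})$ has the same joint distribution on the set of $\sigma\in\mathfrak{S}_n$ with $\mathbf{S}(\mathbf{S}(\sigma))=12\cdots n$ as on the set of $\sigma\in\mathfrak{S}_n$ with $\mathbf{S}(\mathbf{r}(\mathbf{S}(\sigma)))=12\cdots n$.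
   Context: $\mathfrak{S}_n$ is the set of permutations of $\{1,\dots,n\}$, written as words $\pi=\pi_1\cdots\pi_n$. The stack sorting operator $\mathbf{S}$ is defined on words of distinct integers recursively by $\mathbf{S}(\varepsilon)=\varepsilon$ (empty word) and $\mathbf{S}(LmR)=\mathbf{S}(L)\,\mathbf{S}(R)\,m$, where $m$ is the maximum letter of the word $LmR$ (concatenation). The reverse of $\pi\in\mathfrak{S}_n$ is $\mathbf{r}(\pi)=\pi_n\pi_{n-1}\cdots\pi_1$. Statistics on $\pi\in\mathfrak{S}_n$: $\mathrm{des}(\pi)$ = number of $i\in\{1,\dots,n-1\}$ with $\pi_i>\pi_{i+1}$ (descents); $\mathrm{maj}(\pi)$ = sum of the indices $i$ of descents; $\mathrm{rmax}(\pi)$ (resp. $\mathrm{lmax}(\pi)$) = number of right-to-left (resp. left-to-right) maxima, i.e. of $i$ with $\pi_i>\pi_j$ for all $j>i$ (resp. all $j<i$); $\mathrm{valley}$, $\mathrm{peak}$, $\mathrm{ddes}$, $\mathrm{dasc}$ = number of $i\in\{2,\dots,n-1\}$ with respectively $\pi_{i-1}>\pi_i<\pi_{i+1}$, $\pi_{i-1}<\pi_i>\pi_{i+1}$, $\pi_{i-1}>\pi_i>\pi_{i+1}$, $\pi_{i-1}<\pi_i<\pi_{i+1}$; $\mathrm{zeil}(\pi)$ = largest $k$ such that $n(n-1)\cdots(n-k+1)$ is a (not necessarily contiguous) subword of $\pi$; $\mathrm{indmax}(\pi)$ = the index $i$ with $\pi_i=n$; $\mathrm{rir}(\pi)$ (resp.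 $\mathrm{rdr}(\pi)$) = largest $k$ such that $\pi_{n-k+1}<\cdots<\pi_n$ (resp. $\pi_{n-k+1}>\cdots>\pi_n$), i.e. length of the rightmost increasing (resp. decreasing) run; $\mathrm{lir}(\pi)$ (resp. $\mathrm{ldr}(\pi)$) = largest $k$ such that $\pi_1<\cdots<\pi_k$ (resp. $\pi_1>\cdots>\pi_k$); $\mathrm{slmax}(\pi)$ = largest $k$ such that $\pi_1\ge\pi_i$ for all $i\in\{1,\dots,k\}$. *)

theory Defs
  imports
    "HOL-Combinatorics.Multiset_Permutations"
    "HOL-Library.Sublist"
begin

text \<open>
  Permutations are words, i.e. lists: \<open>permutations_of_set {1..n}\<close> is the set of all words
  in which each of \<open>1, \<dots>, n\<close> occurs exactly once.  The statistics below are only meaningful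
  on such words; the size \<open>n\<close> of the permutation is then the length of the word.
\<close>

abbreviation perms :: "nat \<Rightarrow> nat list set" where
  "perms n \<equiv> permutations_of_set {1..n}"

text \<open>Letters are indexed from 1, whereas list positions are indexed from 0.\<close>

definition letter :: "nat list \<Rightarrow> nat \<Rightarrow> nat" where
  "letter w i = w ! (i - 1)"

text \<open>
  For a nonempty word \<open>LmR\<close> with distinct letters and maximum \<open>m\<close>, \<open>L\<close> is the part before
  \<open>m\<close> and \<open>R\<close> is the part after \<open>m\<close>.
\<close>

function stack_sort :: "'a::linorder list \<Rightarrow> 'a list" where
  "stack_sort w =
    (if w = [] then []
     else let m = Max (set w);
              L = takeWhile (\<lambda>x. x \<noteq> m) w;
              R = tl (dropWhile (\<lambda>x. x \<noteq> m) w)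
          in stack_sort L @ stack_sort R @ [m])"
  by pat_completeness auto

termination
proof (relation "measure length")
  fix w L R :: "'a list" and m
  assume w: "w \<noteq> []" and m: "m = Max (set w)"
    and L: "L = takeWhile (\<lambda>x. x \<noteq> m) w"
    and R: "R = tl (dropWhile (\<lambda>x. x \<noteq> m) w)"
  have "m \<in> set w"
    using w m by simp
  then have "dropWhile (\<lambda>x. x \<noteq> m) w \<noteq> []"
    by (auto simp: dropWhile_eq_Nil_conv)
  then have d: "0 < length (dropWhile (\<lambda>x. x \<noteq> m) w)"
    by blast
  have len: "length L + length (dropWhile (\<lambda>x. x \<noteq> m) w) = length w"
    unfolding L by (metis length_append takeWhile_dropWhile_id)
  show "(L, w) \<in> measure length"
    using d len unfolding in_measure by linarith
  show "(R, w) \<in> measure length"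
    using d len unfolding R in_measure length_tl by linarith
qed simp

declare stack_sort.simps [simp del]

lemma stack_sort_Nil: "stack_sort [] = []"
  by (subst stack_sort.simps) simp

lemma stack_sort_append_max:
  assumes "\<forall>x\<in>set L \<union> set R. x < m"
  shows "stack_sort (L @ m # R) = stack_sort L @ stack_sort R @ [m]"
proof -
  have "Max (set (L @ m # R)) = m"
    using assms by (intro Max_eqI) (auto intro: less_imp_le)
  moreover have "takeWhile (\<lambda>x. x \<noteq> m) (L @ m # R) = L"
    using assms by (subst takeWhile_append2) auto
  moreover have "dropWhile (\<lambda>x. x \<noteq> m) (L @ m # R) = m # R"
    using assms by (subst dropWhile_append2) auto
  ultimately show ?thesis
    by (subst stack_sort.simps) (simp add: Let_def)
qed

definition descents :: "nat list \<Rightarrow> nat set" where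
  "descents w = {i \<in> {1..length w - 1}. letter w i > letter w (i + 1)}"

definition des :: "nat list \<Rightarrow> nat" where
  "des w = card (descents w)"

definition maj :: "nat list \<Rightarrow> nat" where
  "maj w = \<Sum>(descents w)"

definition rmax :: "nat list \<Rightarrow> nat" where
  "rmax w = card {i \<in> {1..length w}. \<forall>j\<in>{i<..length w}. letter w i > letter w j}"

definition lmax :: "nat list \<Rightarrow> nat" where
  "lmax w = card {i \<in> {1..length w}. \<forall>j\<in>{1..<i}. letter w i > letter w j}"

definition valley :: "nat list \<Rightarrow> nat" where
  "valley w = card {i \<in> {2..length w - 1}.
     letter w (i - 1) > letter w i \<and> letter w i < letter w (i + 1)}"

definition peak :: "nat list \<Rightarrow> nat" where
  "peak w = card {i \<in> {2..length w - 1}.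
     letter w (i - 1) < letter w i \<and> letter w i > letter w (i + 1)}"

definition ddes :: "nat list \<Rightarrow> nat" where
  "ddes w = card {i \<in> {2..length w - 1}.
     letter w (i - 1) > letter w i \<and> letter w i > letter w (i + 1)}"

definition dasc :: "nat list \<Rightarrow> nat" where
  "dasc w = card {i \<in> {2..length w - 1}.
     letter w (i - 1) < letter w i \<and> letter w i < letter w (i + 1)}"

text \<open>With \<open>n = length w\<close>, the list \<open>rev [n + 1 - k..<n + 1]\<close> is the word
  \<open>n (n - 1) \<dots> (n - k + 1)\<close> of length \<open>k\<close>.\<close>

definition zeil :: "nat list \<Rightarrow> nat" where
  "zeil w = Max {k \<in> {0..length w}. subseq (rev [length w + 1 - k..<length w + 1]) w}"

definition indmax :: "nat list \<Rightarrow> nat" where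
  "indmax w = (THE i. i \<in> {1..length w} \<and> letter w i = length w)"

definition rir :: "nat list \<Rightarrow> nat" where
  "rir w = Max {k \<in> {0..length w}. sorted_wrt (<) (drop (length w - k) w)}"

definition rdr :: "nat list \<Rightarrow> nat" where
  "rdr w = Max {k \<in> {0..length w}. sorted_wrt (>) (drop (length w - k) w)}"

definition lir :: "nat list \<Rightarrow> nat" where
  "lir w = Max {k \<in> {0..length w}. sorted_wrt (<) (take k w)}"

definition ldr :: "nat list \<Rightarrow> nat" where
  "ldr w = Max {k \<in> {0..length w}. sorted_wrt (>) (take k w)}"

definition slmax :: "nat list \<Rightarrow> nat" where
  "slmax w = Max {k \<in> {0..length w}. \<forall>i\<in>{1..k}. letter w 1 \<ge> letter w i}"

text \<open>The word \<open>12\<dots>n\<close> is the list \<open>[1..<n + 1]\<close>.\<close>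

definition sorted_by_SS :: "nat \<Rightarrow> nat list set" where
  "sorted_by_SS n = {\<sigma> \<in> perms n. stack_sort (stack_sort \<sigma>) = [1..<n + 1]}"

definition sorted_by_SrS :: "nat \<Rightarrow> nat list set" where
  "sorted_by_SrS n = {\<sigma> \<in> perms n. stack_sort (rev (stack_sort \<sigma>)) = [1..<n + 1]}"

definition stats ::
  "nat list \<Rightarrow> nat \<times> nat \<times> nat \<times> nat \<times> nat \<times> nat \<times> nat \<times> nat \<times> nat
     \<times> nat \<times> nat \<times> nat \<times> nat \<times> nat \<times> nat" where
  "stats w = (des w, maj w, rmax w, lmax w, valley w, peak w, ddes w, dasc w, zeil w,
     indmax w, rir w, rdr w, lir w, ldr w, slmax w)"

end

(*
  Call two words similar if their decreasing binary trees have the same shape.  Since S reads the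
  decreasing tree of \<sigma> in postorder, \<sigma> is determined by the shape of its tree and by the word S \<sigma>; and
  a word p with |\<sigma>| letters is S of some word similar to \<sigma> as soon as every letter of S \<sigma> exceeding all
  letters back to some position still does so in p.  This has two consequences.  First, every shape
  contains exactly one permutation \<pi> with S \<pi> = 12...n and, by reversal, exactly one with
  S (r \<pi>) = 12...n.  Secondly, replacing S \<sigma> by a similar word p lifts to replacing \<sigma> by a similar
  word.  Hence the pair (shape of \<sigma>, shape of S \<sigma>) identifies \<sigma> in each of the two sets, and the same
  pairs occur in both.  All statistics except zeil depend on the shape of \<sigma> alone, while
  zeil \<sigma> is the minimum of rmax \<sigma> and of the number of final letters of S \<sigma> that are
  left-to-right maxima, which depends on the two shapes.
*)

theory Submission
  imports Defs
begin

section \<open>Shapes of decreasing binary trees\<close>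

definition dominates :: "'a::linorder list \<Rightarrow> nat \<Rightarrow> nat \<Rightarrow> bool" where
  "dominates w i j \<longleftrightarrow> (\<forall>k. min i j \<le> k \<and> k \<le> max i j \<and> k \<noteq> i \<longrightarrow> w ! k < w ! i)"

text \<open>For words with distinct letters, \<open>dominates w i j\<close> says that position \<open>i\<close> is an ancestor of
  (or equal to) position \<open>j\<close> in the decreasing binary tree of \<open>w\<close>, so that the relation
  \<open>dominates w\<close> encodes the shape of this tree.\<close>

definition same_shape :: "'a::linorder list \<Rightarrow> 'b::linorder list \<Rightarrow> bool" where
  "same_shape u v \<longleftrightarrow> length u = length v \<and>
     (\<forall>i<length u. \<forall>j<length u. dominates u i j \<longleftrightarrow> dominates v i j)"

lemma same_shape_sym: "same_shape u v \<Longrightarrow> same_shape v u"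
  by (auto simp: same_shape_def)

lemma same_shape_trans: "same_shape u v \<Longrightarrow> same_shape v w \<Longrightarrow> same_shape u w"
  by (auto simp: same_shape_def)

text \<open>Dominance looks only at the letters between the two positions, so it is not affected by
  what surrounds a factor containing both.\<close>

lemma dominates_append:
  assumes "i < length v" "j < length v"
  shows "dominates (u @ v @ w) (length u + i) (length u + j) \<longleftrightarrow> dominates v i j"
proof
  assume *: "dominates (u @ v @ w) (length u + i) (length u + j)"
  show "dominates v i j"
    unfolding dominates_def
  proof (intro allI impI)
    fix k assume k: "min i j \<le> k \<and> k \<le> max i j \<and> k \<noteq> i"
    then have "k < length v" using assms by auto
    moreover have "(u @ v @ w) ! (length u + k) < (u @ v @ w) ! (length u + i)"
      by (intro *[unfolded dominates_def, rule_format]) (use k in auto)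
    ultimately show "v ! k < v ! i"
      using assms by (simp add: nth_append)
  qed
next
  assume *: "dominates v i j"
  show "dominates (u @ v @ w) (length u + i) (length u + j)"
    unfolding dominates_def
  proof (intro allI impI)
    fix k assume k: "min (length u + i) (length u + j) \<le> k \<and> k \<le> max (length u + i) (length u + j)
      \<and> k \<noteq> length u + i"
    then obtain k' where k': "k = length u + k'"
      by (metis add_le_cancel_left le_add1 le_trans min_def nat_le_iff_add)
    then have "min i j \<le> k' \<and> k' \<le> max i j \<and> k' \<noteq> i" "k' < length v"
      using k assms by (auto simp: min_def max_def split: if_splits)
    then have "v ! k' < v ! i" using * unfolding dominates_def by blast
    then show "(u @ v @ w) ! k < (u @ v @ w) ! (length u + i)"
      using assms k' \<open>k' < length v\<close> by (simp add: nth_append)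
  qed
qed

lemma same_shape_infix:
  assumes "same_shape (u @ v @ w) (u' @ v' @ w')"
    and len: "length u = length u'" "length v = length v'"
  shows "same_shape v v'"
  unfolding same_shape_def
proof (intro conjI allI impI)
  fix i j assume ij: "i < length v" "j < length v"
  then have "dominates (u @ v @ w) (length u + i) (length u + j)
      \<longleftrightarrow> dominates (u' @ v' @ w') (length u + i) (length u + j)"
    using assms by (auto simp: same_shape_def)
  then show "dominates v i j \<longleftrightarrow> dominates v' i j"
    using ij len by (metis dominates_append)
qed (rule len)

text \<open>This is the recursion of the decreasing tree: \<open>m\<close> is the root, with
  \<open>L\<close> and \<open>R\<close> as left and right subtrees. A position other than that of
  \<open>m\<close> cannot dominate anything at or across \<open>m\<close>, since the range in
  question then contains \<open>m\<close>.\<close>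

lemma dominates_append_max:
  assumes max: "\<forall>x\<in>set L \<union> set R. x < m"
    and i: "i < length (L @ m # R)" and j: "j < length (L @ m # R)"
  shows "dominates (L @ m # R) i j \<longleftrightarrow>
    (if i < length L then j < length L \<and> dominates L i j
     else i = length L \<or> length L < j \<and> dominates R (i - Suc (length L)) (j - Suc (length L)))"
proof -
  have nth: "(L @ m # R) ! k < m" if "k < length (L @ m # R)" "k \<noteq> length L" for k
    using that max by (auto simp: nth_append nth_Cons split: nat.split)
  have below: "\<not> dominates (L @ m # R) i j"
    if "i \<noteq> length L" "min i j \<le> length L" "length L \<le> max i j"
  proof
    assume "dominates (L @ m # R) i j"
    then have "(L @ m # R) ! length L < (L @ m # R) ! i"
      using that unfolding dominates_def by metis
    then show False using nth[OF i that(1)] by simp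
  qed
  consider "i < length L" "j < length L" | "i < length L" "length L \<le> j" | "i = length L"
    | "length L < i" "length L < j" | "length L < i" "j \<le> length L"
    by linarith
  then show ?thesis
  proof cases
    case 1
    then show ?thesis using dominates_append[of i L j "[]" "m # R"] by simp
  next
    case 2
    then show ?thesis using below by auto
  next
    case 3
    have "dominates (L @ m # R) i j"
      unfolding dominates_def using nth i j 3 by auto
    then show ?thesis using 3 by simp
  next
    case 4
    then show ?thesis
      using dominates_append[of "i - Suc (length L)" R "j - Suc (length L)" "L @ [m]" "[]"] i j
      by simp
  next
    case 5
    then show ?thesis using below by auto
  qed
qed

lemma same_shape_append_max:
  assumes "\<forall>x\<in>set L \<union> set R. x < m" "\<forall>x\<in>set L' \<union> set R'. x < m'"
    and "same_shape L L'" "same_shape R R'"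
  shows "same_shape (L @ m # R) (L' @ m' # R')"
proof -
  have len: "length L = length L'" "length R = length R'"
    using assms by (auto simp: same_shape_def)
  show ?thesis
    unfolding same_shape_def
  proof (intro conjI allI impI)
    fix i j assume ij: "i < length (L @ m # R)" "j < length (L @ m # R)"
    then have ij': "i < length (L' @ m' # R')" "j < length (L' @ m' # R')"
      using len by auto
    show "dominates (L @ m # R) i j \<longleftrightarrow> dominates (L' @ m' # R') i j"
      unfolding dominates_append_max[OF assms(1) ij] dominates_append_max[OF assms(2) ij']
      using ij assms(3,4) len by (auto simp: same_shape_def)
  qed (use len in simp)
qed

lemma dominates_rev:
  assumes "i < length w" "j < length w"
  shows "dominates (rev w) i j \<longleftrightarrow> dominates w (length w - Suc i) (length w - Suc j)"
proof -
  \<comment> \<open>Proved for arbitrary words, so that its instance for \<open>rev w\<close> yields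
    the converse direction.\<close>
  have imp: "dominates (rev w) i j"
    if ij: "i < length w" "j < length w" and d: "dominates w (length w - Suc i) (length w - Suc j)"
    for w :: "'a list" and i j
    unfolding dominates_def
  proof (intro allI impI)
    fix k assume k: "min i j \<le> k \<and> k \<le> max i j \<and> k \<noteq> i"
    then have "k < length w" using ij by auto
    moreover have "w ! (length w - Suc k) < w ! (length w - Suc i)"
      by (intro d[unfolded dominates_def, rule_format]) (use k ij in auto)
    ultimately show "rev w ! k < rev w ! i"
      using ij by (simp add: rev_nth)
  qed
  have "dominates (rev (rev w)) (length w - Suc i) (length w - Suc j)" if "dominates (rev w) i j"
    by (rule imp) (use assms that in auto)
  then show ?thesis using imp assms by auto
qed

lemma same_shape_rev: "same_shape u v \<Longrightarrow> same_shape (rev u) (rev v)"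
  by (auto simp: same_shape_def dominates_rev)

section \<open>Splitting words with distinct letters at the maximum\<close>

lemma distinct_max_decomp:
  fixes w :: "'a::linorder list"
  assumes "distinct w" "w \<noteq> []"
  obtains L m R where "w = L @ m # R" "\<forall>x\<in>set L \<union> set R. x < m"
proof -
  have "Max (set w) \<in> set w" using assms(2) by simp
  then obtain L R where w: "w = L @ Max (set w) # R" by (meson split_list)
  have "x < Max (set w)" if "x \<in> set L \<union> set R" for x
  proof -
    have "x \<in> set w" using w that by (metis Un_iff set_append set_subset_Cons subsetD)
    moreover have "x \<noteq> Max (set w)"
      using assms(1) w that by (metis Un_iff disjoint_insert(1) distinct.simps(2)
          distinct_append list.simps(15))
    ultimately show ?thesis by (simp add: less_le)
  qed
  with w show ?thesis using that by blast
qed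

text \<open>The induction follows the recursion of \<open>stack_sort\<close>, that is, it runs over
  both subtrees of the root.\<close>

lemma distinct_max_induct [consumes 1, case_names Nil append_max]:
  fixes w :: "'a::linorder list"
  assumes "distinct w"
    and "P []"
    and step: "\<And>L m R. distinct L \<Longrightarrow> distinct R \<Longrightarrow> set L \<inter> set R = {} \<Longrightarrow>
      \<forall>x\<in>set L \<union> set R. x < m \<Longrightarrow> P L \<Longrightarrow> P R \<Longrightarrow> P (L @ m # R)"
  shows "P w"
  using assms(1)
proof (induction w rule: length_induct)
  case (1 w)
  show ?case
  proof (cases "w = []")
    case False
    obtain L m R where w: "w = L @ m # R" "\<forall>x\<in>set L \<union> set R. x < m"
      using distinct_max_decomp[OF 1(2) False] .
    show ?thesis
      unfolding w(1)
      by (rule step) (use w 1 in auto)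
  qed (simp add: assms(2))
qed

section \<open>Stack sorting within a fixed shape\<close>

lemma mset_stack_sort: "distinct w \<Longrightarrow> mset (stack_sort w) = mset w"
  by (induction w rule: distinct_max_induct)
    (simp_all add: stack_sort_Nil stack_sort_append_max)

lemma
  assumes "distinct w"
  shows length_stack_sort: "length (stack_sort w) = length w"
    and set_stack_sort: "set (stack_sort w) = set w"
    and distinct_stack_sort: "distinct (stack_sort w)"
  using mset_stack_sort[OF assms] assms
  by (metis size_mset, metis set_mset_mset, metis mset_eq_imp_distinct_iff)

text \<open>The shape fixes the position of the maximum, hence the lengths of both subtrees. These
  lengths tell where the sorted word splits into its blocks for \<open>L\<close>, \<open>R\<close>
  and the root, and each subtree is recovered from its own block.\<close>

lemma same_shape_stack_sort_inj:
  fixes u v :: "'a::linorder list"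
  assumes "distinct u" "distinct v" "same_shape u v" "stack_sort u = stack_sort v"
  shows "u = v"
  using assms
proof (induction u arbitrary: v rule: distinct_max_induct)
  case Nil
  then show ?case by (simp add: same_shape_def)
next
  case (append_max L m R)
  have len: "length v = length (L @ m # R)" using append_max by (simp add: same_shape_def)
  then have "v \<noteq> []" by auto
  then obtain L' m' R' where v: "v = L' @ m' # R'" and max': "\<forall>x\<in>set L' \<union> set R'. x < m'"
    using distinct_max_decomp append_max.prems(1) by metis
  \<comment> \<open>The position of the maximum of the first word dominates that of the second. By
    equality of shapes it does so in \<open>v\<close> as well, where the position of the maximum is
    dominated by itself alone; so the two positions coincide.\<close>
  have "dominates (L @ m # R) (length L) (length L')"
    using append_max.hyps(4) len v by (subst dominates_append_max) auto
  then have "dominates (L' @ m' # R') (length L) (length L')"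
    using append_max.prems(2) len v by (simp add: same_shape_def)
  then have lenL: "length L = length L'"
    using max' len v by (subst (asm) dominates_append_max) (auto split: if_splits)
  then have lenR: "length R = length R'" using len v by simp
  have "same_shape L L'"
    using same_shape_infix[of "[]" L "m # R" "[]" L' "m' # R'"] append_max.prems(2) v lenL by simp
  moreover have "same_shape R R'"
    using same_shape_infix[of "L @ [m]" R "[]" "L' @ [m']" R' "[]"] append_max.prems(2) v lenL lenR
    by simp
  moreover have d: "distinct L'" "distinct R'" using append_max.prems(1) v by auto
  moreover have "stack_sort L = stack_sort L'" "stack_sort R = stack_sort R'" "m = m'"
    using append_max.prems(3) append_max.hyps d lenL lenR max'
    by (simp_all add: v stack_sort_append_max length_stack_sort)
  ultimately have "L = L'" "R = R'"
    by (auto intro: append_max.IH)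
  with \<open>m = m'\<close> show ?case by (simp add: v)
qed

text \<open>The desired \<open>v\<close> is found by filling the tree of \<open>w\<close> in
  postorder with the letters of \<open>p\<close>. The assumption makes every node larger than its
  descendants: in postorder these stand immediately before it, and in \<open>stack_sort w\<close>
  the node exceeds all of them.\<close>

lemma stack_sort_lift:
  fixes w p :: "'a::linorder list"
  assumes "distinct w" "length p = length w"
    and "\<And>i j. i < j \<Longrightarrow> j < length w \<Longrightarrow> dominates (stack_sort w) j i \<Longrightarrow> dominates p j i"
  shows "\<exists>v. same_shape w v \<and> mset v = mset p \<and> stack_sort v = p"
  using assms
proof (induction w arbitrary: p rule: distinct_max_induct)
  case Nil
  then show ?case by (auto simp: same_shape_def stack_sort_Nil)
next
  case (append_max L m R)
  \<comment> \<open>These are the postorder blocks of \<open>p\<close>: left subtree, right subtree,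
    root.\<close>
  define A B m' where "A = take (length L) p" and "B = take (length R) (drop (length L) p)"
    and "m' = last p"
  have "p \<noteq> []" using append_max.prems(1) by auto
  have "take (length L + length R) p = A @ B"
    unfolding A_def B_def by (simp add: take_add)
  moreover have "take (length L + length R) p = butlast p"
    using append_max.prems(1) by (simp add: butlast_conv_take)
  ultimately have p: "p = A @ B @ [m']"
    using \<open>p \<noteq> []\<close> unfolding m'_def by (metis append.assoc append_butlast_last_id)
  have lenA: "length A = length L" and lenB: "length B = length R"
    using append_max.prems(1) unfolding A_def B_def by auto
  have S: "stack_sort (L @ m # R) = stack_sort L @ stack_sort R @ [m]"
    using append_max.hyps(4) by (rule stack_sort_append_max)
  have len: "length (stack_sort L) = length L" "length (stack_sort R) = length R"
    and sets: "set (stack_sort L) = set L" "set (stack_sort R) = set R"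
    using append_max.hyps by (simp_all add: length_stack_sort set_stack_sort)
  \<comment> \<open>\<open>stack_sort w\<close> ends in its maximum, so its last position dominates
    all others; the assumption transfers this to \<open>p\<close>.\<close>
  have "x < m'" if x: "x \<in> set (A @ B)" for x
  proof -
    obtain i where i: "i < length (A @ B)" "x = (A @ B) ! i"
      using x by (metis in_set_conv_nth)
    have "dominates ((stack_sort L @ stack_sort R) @ m # []) (length (stack_sort L @ stack_sort R)) i"
      using append_max.hyps(4) i lenA lenB len sets by (subst dominates_append_max) auto
    then have "dominates p (length L + length R) i"
      using append_max.prems(2)[of i "length L + length R"] i lenA lenB len S by simp
    moreover have "p ! (length L + length R) = m'" "p ! i = x"
      using i lenA lenB by (auto simp: p nth_append)
    ultimately show ?thesis
      using i lenA lenB unfolding dominates_def by (auto simp: min_def max_def)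
  qed
  then have max': "\<forall>x\<in>set A \<union> set B. x < m'" by auto
  have "\<exists>v. same_shape L v \<and> mset v = mset A \<and> stack_sort v = A"
  proof (rule append_max.IH(1)[OF lenA])
    fix i j assume ij: "i < j" "j < length L" "dominates (stack_sort L) j i"
    then have "dominates (stack_sort (L @ m # R)) j i"
      using dominates_append[of j "stack_sort L" i "[]" "stack_sort R @ [m]"] S len by simp
    then have "dominates p j i" using append_max.prems(2) ij by simp
    then show "dominates A j i"
      using dominates_append[of j A i "[]" "B @ [m']"] ij lenA p by simp
  qed
  then obtain L' where L': "same_shape L L'" "mset L' = mset A" "stack_sort L' = A" by blast
  have "\<exists>v. same_shape R v \<and> mset v = mset B \<and> stack_sort v = B"
  proof (rule append_max.IH(2)[OF lenB])
    fix i j assume ij: "i < j" "j < length R" "dominates (stack_sort R) j i"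
    then have "dominates (stack_sort (L @ m # R)) (length L + j) (length L + i)"
      using dominates_append[of j "stack_sort R" i "stack_sort L" "[m]"] S len by simp
    then have "dominates p (length L + j) (length L + i)" using append_max.prems(2) ij by simp
    then show "dominates B j i"
      using dominates_append[of j B i A "[m']"] ij lenA lenB p by simp
  qed
  then obtain R' where R': "same_shape R R'" "mset R' = mset B" "stack_sort R' = B" by blast
  have max'': "\<forall>x\<in>set L' \<union> set R'. x < m'"
    using max' L'(2) R'(2) by (metis set_mset_mset)
  have "same_shape (L @ m # R) (L' @ m' # R')"
    using append_max.hyps(4) max'' L'(1) R'(1) by (rule same_shape_append_max)
  moreover have "stack_sort (L' @ m' # R') = p"
    using stack_sort_append_max[OF max''] L' R' p by simp
  moreover have "mset (L' @ m' # R') = mset p"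
    using L' R' p by simp
  ultimately show ?case by blast
qed

section \<open>Statistics determined by the shape alone\<close>

lemma letter_dominates_right:
  "1 \<le> i \<Longrightarrow> i \<le> j \<Longrightarrow> (\<forall>k\<in>{i<..j}. letter w k < letter w i) \<longleftrightarrow> dominates w (i - 1) (j - 1)"
proof (intro iffI ballI)
  assume ij: "1 \<le> i" "i \<le> j" and *: "\<forall>k\<in>{i<..j}. letter w k < letter w i"
  have "letter w (Suc k) < letter w i"
    if "min (i - 1) (j - 1) \<le> k \<and> k \<le> max (i - 1) (j - 1) \<and> k \<noteq> i - 1" for k
    by (intro *[rule_format]) (use that ij in auto)
  then show "dominates w (i - 1) (j - 1)"
    by (auto simp: dominates_def letter_def)
next
  fix k assume ij: "1 \<le> i" "i \<le> j" "k \<in> {i<..j}" and d: "dominates w (i - 1) (j - 1)"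
  show "letter w k < letter w i"
    unfolding letter_def by (intro d[unfolded dominates_def, rule_format]) (use ij in auto)
qed

lemma letter_dominates_left:
  "1 \<le> i \<Longrightarrow> i \<le> j \<Longrightarrow> (\<forall>k\<in>{i..<j}. letter w k < letter w j) \<longleftrightarrow> dominates w (j - 1) (i - 1)"
proof (intro iffI ballI)
  assume ij: "1 \<le> i" "i \<le> j" and *: "\<forall>k\<in>{i..<j}. letter w k < letter w j"
  have "letter w (Suc k) < letter w j"
    if "min (j - 1) (i - 1) \<le> k \<and> k \<le> max (j - 1) (i - 1) \<and> k \<noteq> j - 1" for k
    by (intro *[rule_format]) (use that ij in auto)
  then show "dominates w (j - 1) (i - 1)"
    by (auto simp: dominates_def letter_def)
next
  fix k assume ij: "1 \<le> i" "i \<le> j" "k \<in> {i..<j}" and d: "dominates w (j - 1) (i - 1)"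
  show "letter w k < letter w j"
    unfolding letter_def by (intro d[unfolded dominates_def, rule_format]) (use ij in auto)
qed

context
  fixes u v :: "nat list"
  assumes shape: "same_shape u v"
begin

lemma same_shape_length: "length u = length v"
  using shape by (simp add: same_shape_def)

text \<open>Together with its mirror image below, this transfers the letter comparisons in the
  statistics between words of equal shape. For \<open>i > j\<close> both ranges are empty.\<close>

lemma same_shape_letter_right:
  assumes "1 \<le> i" "j \<le> length v"
  shows "(\<forall>k\<in>{i<..j}. letter u k < letter u i) \<longleftrightarrow> (\<forall>k\<in>{i<..j}. letter v k < letter v i)"
proof (cases "i \<le> j")
  case True
  then have "i - 1 < length u" "j - 1 < length u" using assms same_shape_length by auto
  then show ?thesis
    using letter_dominates_right[OF assms(1) True] shape by (simp add: same_shape_def)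
qed auto

lemma same_shape_letter_left:
  assumes "1 \<le> i" "j \<le> length v"
  shows "(\<forall>k\<in>{i..<j}. letter u k < letter u j) \<longleftrightarrow> (\<forall>k\<in>{i..<j}. letter v k < letter v j)"
proof (cases "i \<le> j")
  case True
  then have "i - 1 < length u" "j - 1 < length u" using assms same_shape_length by auto
  then show ?thesis
    using letter_dominates_left[OF assms(1) True] shape by (simp add: same_shape_def)
qed auto

lemma same_shape_descent:
  assumes "1 \<le> i" "i < length v"
  shows "letter u (Suc i) < letter u i \<longleftrightarrow> letter v (Suc i) < letter v i"
proof -
  \<comment> \<open>A descent is dominance of the right neighbour.\<close>
  have "{i<..Suc i} = {Suc i}" by auto
  then show ?thesis using same_shape_letter_right[of i "Suc i"] assms by simp
qed

lemma same_shape_ascent: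
  assumes "1 \<le> i" "i < length v"
  shows "letter u i < letter u (Suc i) \<longleftrightarrow> letter v i < letter v (Suc i)"
  using same_shape_letter_left[of i "Suc i"] assms by simp

lemma same_shape_descents: "descents u = descents v"
  unfolding descents_def same_shape_length using same_shape_descent by auto

lemma same_shape_rmax: "rmax u = rmax v"
proof -
  have "{i \<in> {1..length v}. \<forall>j\<in>{i<..length v}. letter u j < letter u i} =
      {i \<in> {1..length v}. \<forall>j\<in>{i<..length v}. letter v j < letter v i}"
    by (intro Collect_cong conj_cong refl same_shape_letter_right) auto
  then show ?thesis by (simp add: rmax_def same_shape_length)
qed

lemma same_shape_lmax: "lmax u = lmax v"
proof -
  have "{i \<in> {1..length v}. \<forall>j\<in>{1..<i}. letter u j < letter u i} =
      {i \<in> {1..length v}. \<forall>j\<in>{1..<i}. letter v j < letter v i}"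
    by (intro Collect_cong conj_cong refl same_shape_letter_left) auto
  then show ?thesis by (simp add: lmax_def same_shape_length)
qed

lemma
  shows same_shape_valley: "valley u = valley v" and same_shape_peak: "peak u = peak v"
    and same_shape_ddes: "ddes u = ddes v" and same_shape_dasc: "dasc u = dasc v"
proof -
  have "(letter u i < letter u (i - 1) \<longleftrightarrow> letter v i < letter v (i - 1)) \<and>
      (letter u (i - 1) < letter u i \<longleftrightarrow> letter v (i - 1) < letter v i) \<and>
      (letter u (i + 1) < letter u i \<longleftrightarrow> letter v (i + 1) < letter v i) \<and>
      (letter u i < letter u (i + 1) \<longleftrightarrow> letter v i < letter v (i + 1))"
    if "i \<in> {2..length v - 1}" for i
    \<comment> \<open>The comparison with the left neighbour is a descent or ascent at
      \<open>i - 1\<close>.\<close>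
    using that same_shape_descent[of i] same_shape_ascent[of i]
      same_shape_descent[of "i - 1"] same_shape_ascent[of "i - 1"]
    by (auto simp: Suc_diff_le numeral_2_eq_2)
  note * = this
  show "valley u = valley v" "peak u = peak v" "ddes u = ddes v" "dasc u = dasc v"
    unfolding valley_def peak_def ddes_def dasc_def same_shape_length
    by (intro arg_cong[where f = card] Collect_cong conj_cong refl; use * in blast)+
qed

end

text \<open>By transitivity a monotone run is a condition on consecutive letters, hence on descents
  or ascents, which the shape determines.\<close>

lemma sorted_wrt_drop_letter:
  assumes "transp P"
  shows "sorted_wrt P (drop a w) \<longleftrightarrow> (\<forall>i\<in>{Suc a..<length w}. P (letter w i) (letter w (Suc i)))"
proof -
  have "sorted_wrt P (drop a w) \<longleftrightarrow> (\<forall>i. Suc a + i < length w \<longrightarrow> P (w ! (a + i)) (w ! Suc (a + i)))"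
    unfolding sorted_wrt_iff_nth_Suc_transp[OF assms] by (auto simp: less_diff_conv add.commute)
  also have "\<dots> \<longleftrightarrow> (\<forall>i\<in>{Suc a..<length w}. P (letter w i) (letter w (Suc i)))"
  proof safe
    fix i assume *: "\<forall>i. Suc a + i < length w \<longrightarrow> P (w ! (a + i)) (w ! Suc (a + i))"
      and i: "i \<in> {Suc a..<length w}"
    then show "P (letter w i) (letter w (Suc i))"
      using *[rule_format, of "i - Suc a"] by (simp add: letter_def Suc_diff_le)
  next
    fix i assume *: "\<forall>i\<in>{Suc a..<length w}. P (letter w i) (letter w (Suc i))"
      and i: "Suc a + i < length w"
    then show "P (w ! (a + i)) (w ! Suc (a + i))"
      using *[rule_format, of "Suc (a + i)"] by (simp add: letter_def)
  qed
  finally show ?thesis .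
qed

lemma sorted_wrt_take_letter:
  assumes "transp P" "k \<le> length w"
  shows "sorted_wrt P (take k w) \<longleftrightarrow> (\<forall>i\<in>{1..<k}. P (letter w i) (letter w (Suc i)))"
proof -
  have "letter (take k w) i = letter w i" if "1 \<le> i" "i \<le> k" for i
    using that by (simp add: letter_def)
  then show ?thesis
    using sorted_wrt_drop_letter[OF assms(1), of 0 "take k w"] assms(2) by simp
qed

lemma
  assumes shape: "same_shape u v"
  shows same_shape_rir: "rir u = rir v" and same_shape_rdr: "rdr u = rdr v"
    and same_shape_lir: "lir u = lir v" and same_shape_ldr: "ldr u = ldr v"
proof -
  note len = same_shape_length[OF shape]
  have "sorted_wrt (<) (drop a u) \<longleftrightarrow> sorted_wrt (<) (drop a v)"
    "sorted_wrt (>) (drop a u) \<longleftrightarrow> sorted_wrt (>) (drop a v)" for a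
    using same_shape_ascent[OF shape] same_shape_descent[OF shape] len
    by (auto simp: sorted_wrt_drop_letter)
  then show "rir u = rir v" "rdr u = rdr v"
    by (simp_all add: rir_def rdr_def len)
  have "sorted_wrt (<) (take k u) \<longleftrightarrow> sorted_wrt (<) (take k v)"
    "sorted_wrt (>) (take k u) \<longleftrightarrow> sorted_wrt (>) (take k v)" if "k \<le> length v" for k
    using same_shape_ascent[OF shape] same_shape_descent[OF shape] len that
    by (auto simp: sorted_wrt_take_letter)
  then show "lir u = lir v" "ldr u = ldr v"
    unfolding lir_def ldr_def len
    by (intro arg_cong[where f = Max] Collect_cong conj_cong refl; simp)+
qed

lemma permutations_of_set_iff: "w \<in> permutations_of_set A \<longleftrightarrow> distinct w \<and> set w = A"
  by (auto simp: permutations_of_set_def)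

lemma perms_length: "w \<in> perms n \<Longrightarrow> length w = n"
  by (metis permutations_of_set_iff card_atLeastAtMost diff_Suc_1 distinct_card)

lemma perms_letter_eq_iff:
  assumes "w \<in> perms n" "i \<in> {1..n}" "j \<in> {1..n}"
  shows "letter w i = letter w j \<longleftrightarrow> i = j"
  using assms perms_length[OF assms(1)] by (auto simp: permutations_of_set_iff letter_def nth_eq_iff_index_eq)

lemma perms_letter_bounds:
  assumes "w \<in> perms n" "i \<in> {1..n}"
  shows "letter w i \<in> {1..n}"
  using assms perms_length[OF assms(1)] nth_mem[of "i - 1" w] by (auto simp: permutations_of_set_iff letter_def)

text \<open>Needed for \<open>indmax\<close>: it expresses the position of \<open>n\<close> by
  comparisons to the right and to the left, which the shape preserves.\<close>

lemma perms_letter_eq_length_iff: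
  assumes w: "w \<in> perms n" and i: "i \<in> {1..n}"
  shows "letter w i = n \<longleftrightarrow>
    (\<forall>k\<in>{i<..n}. letter w k < letter w i) \<and> (\<forall>k\<in>{1..<i}. letter w k < letter w i)"
proof
  assume n: "letter w i = n"
  have "letter w k < letter w i" if "k \<in> {1..n}" "k \<noteq> i" for k
    using perms_letter_eq_iff[OF w that(1) i] perms_letter_bounds[OF w that(1)] that n by auto
  then show "(\<forall>k\<in>{i<..n}. letter w k < letter w i) \<and> (\<forall>k\<in>{1..<i}. letter w k < letter w i)"
    using i by auto
next
  assume *: "(\<forall>k\<in>{i<..n}. letter w k < letter w i) \<and> (\<forall>k\<in>{1..<i}. letter w k < letter w i)"
  have "n \<in> set w" using w i by (auto simp: permutations_of_set_iff)
  then obtain k where k: "k < n" "w ! k = n"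
    using perms_length[OF w] by (metis in_set_conv_nth)
  then have "letter w (Suc k) = n" by (simp add: letter_def)
  moreover have "letter w i \<le> n" using perms_letter_bounds[OF w i] by simp
  moreover have "Suc k \<in> {i<..n} \<or> Suc k \<in> {1..<i} \<or> Suc k = i" using k by auto
  ultimately show "letter w i = n" using * by fastforce
qed

lemma
  assumes shape: "same_shape u v" and u: "u \<in> perms n" and v: "v \<in> perms n"
  shows same_shape_indmax: "indmax u = indmax v" and same_shape_slmax: "slmax u = slmax v"
proof -
  note len = perms_length[OF u] perms_length[OF v]
  have "letter u i = n \<longleftrightarrow> letter v i = n" if "i \<in> {1..n}" for i
    using same_shape_letter_right[OF shape, of i n] same_shape_letter_left[OF shape, of 1 i] that
    by (simp add: perms_letter_eq_length_iff[OF u that] perms_letter_eq_length_iff[OF v that] len)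
  then show "indmax u = indmax v"
    unfolding indmax_def len by (metis (no_types))
  \<comment> \<open>\<open>slmax\<close> uses a weak comparison, dominance a strict one; as the
    letters are distinct, the two differ only at position 1 itself.\<close>
  have *: "(\<forall>i\<in>{1..k}. letter w i \<le> letter w 1) \<longleftrightarrow> (\<forall>i\<in>{1<..k}. letter w i < letter w 1)"
    if w: "w \<in> perms n" and k: "k \<le> n" for w k
  proof
    assume le: "\<forall>i\<in>{1..k}. letter w i \<le> letter w 1"
    show "\<forall>i\<in>{1<..k}. letter w i < letter w 1"
    proof
      fix i assume "i \<in> {1<..k}"
      then show "letter w i < letter w 1"
        using le perms_letter_eq_iff[OF w, of i 1] k by (simp add: order.strict_iff_order)
    qed
  next
    assume lt: "\<forall>i\<in>{1<..k}. letter w i < letter w 1"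
    show "\<forall>i\<in>{1..k}. letter w i \<le> letter w 1"
    proof
      fix i assume "i \<in> {1..k}"
      then show "letter w i \<le> letter w 1"
        using lt by (cases "i = 1") (auto intro: less_imp_le)
    qed
  qed
  have "(\<forall>i\<in>{1..k}. letter u i \<le> letter u 1) \<longleftrightarrow> (\<forall>i\<in>{1..k}. letter v i \<le> letter v 1)"
    if "k \<le> n" for k
    unfolding *[OF u that] *[OF v that]
    using same_shape_letter_right[OF shape, of 1 k] that len by simp
  then show "slmax u = slmax v"
    unfolding slmax_def len
    by (intro arg_cong[where f = Max] Collect_cong conj_cong refl) simp
qed

section \<open>The statistic \<open>zeil\<close> in terms of two shapes\<close>

lemma rmax_le_length: "rmax w \<le> length w"
  unfolding rmax_def by (rule order_trans[OF card_mono[of "{1..length w}"]]) auto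

text \<open>The letter \<open>m\<close> hides everything in \<open>L\<close> when the word is read
  from the right, is itself a right-to-left maximum, and leaves those of \<open>R\<close>
  unchanged.\<close>

lemma rmax_append_max:
  assumes max: "\<forall>x\<in>set L \<union> set R. x < m"
  shows "rmax (L @ m # R) = Suc (rmax R)"
proof -
  \<comment> \<open>\<open>l\<close> is the 1-based index of \<open>m\<close>; a letter of
    \<open>R\<close> with index \<open>k\<close> has index \<open>l + k\<close> in the whole
    word.\<close>
  define l where "l = Suc (length L)"
  define M where "M = {i \<in> {1..length R}. \<forall>j\<in>{i<..length R}. letter R j < letter R i}"
  have nth: "(L @ m # R) ! k < m" if "k < length (L @ m # R)" "k \<noteq> length L" for k
    using that max by (auto simp: nth_append nth_Cons split: nat.split)
  have letter_m: "letter (L @ m # R) l = m" by (simp add: letter_def l_def)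
  have less: "letter (L @ m # R) k < m" if "k \<in> {1..l + length R}" "k \<noteq> l" for k
    unfolding letter_def by (rule nth) (use that in \<open>auto simp: l_def\<close>)
  have letter_R: "letter (L @ m # R) (l + k) = letter R k" if "1 \<le> k" for k
    using that by (cases k) (simp_all add: letter_def l_def nth_append)
  have "{i \<in> {1..length (L @ m # R)}. \<forall>j\<in>{i<..length (L @ m # R)}.
      letter (L @ m # R) j < letter (L @ m # R) i} = insert l ((+) l ` M)" (is "?A = ?B")
  proof (intro equalityI subsetI)
    fix i assume i: "i \<in> ?A"
    then have i_ge: "1 \<le> i" by simp
    have "\<not> i < l"
    proof
      assume "i < l"
      then have "l \<in> {i<..length (L @ m # R)}" by (simp add: l_def)
      then have "letter (L @ m # R) l < letter (L @ m # R) i" using i by blast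
      then have "m < letter (L @ m # R) i" by (simp only: letter_m)
      moreover have "letter (L @ m # R) i < m"
        by (rule less) (use i_ge \<open>i < l\<close> in auto)
      ultimately show False by simp
    qed
    moreover have "i \<in> (+) l ` M" if l: "l < i"
    proof -
      obtain k where k: "i = l + k" "1 \<le> k"
        by (rule that[of "i - l"]) (use l in auto)
      have "letter R j < letter R k" if "j \<in> {k<..length R}" for j
      proof -
        have "l + j \<in> {i<..length (L @ m # R)}" using that k by (simp add: l_def)
        then have "letter (L @ m # R) (l + j) < letter (L @ m # R) (l + k)" using i k by blast
        then show ?thesis using letter_R[of j] letter_R[of k] that k by simp
      qed
      then show ?thesis using i k by (auto simp: M_def l_def)
    qed
    ultimately show "i \<in> ?B" by (metis insertCI linorder_neqE_nat)
  next
    fix i assume "i \<in> ?B"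
    then consider "i = l" | k where "i = l + k" "k \<in> M" by auto
    then show "i \<in> ?A"
    proof cases
      case 1
      then show ?thesis using letter_m less by (auto simp: l_def)
    next
      case 2
      have "letter (L @ m # R) j < letter (L @ m # R) i"
        if j: "j \<in> {i<..length (L @ m # R)}" for j
      proof -
        have k: "1 \<le> k" "\<forall>j\<in>{k<..length R}. letter R j < letter R k" using 2 by (auto simp: M_def)
        have "j - l \<in> {k<..length R}" and j_eq: "j = l + (j - l)"
          using j 2 by (auto simp: l_def)
        then have "letter R (j - l) < letter R k" using k by blast
        moreover have "letter (L @ m # R) j = letter R (j - l)"
          using letter_R[of "j - l"] \<open>j - l \<in> {k<..length R}\<close> j_eq by simp
        ultimately show ?thesis using letter_R[OF k(1)] 2 by simp
      qed
      then show ?thesis using 2 by (auto simp: M_def l_def)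
    qed
  qed
  moreover have "card (insert l ((+) l ` M)) = Suc (card M)"
    by (subst card_insert_disjoint) (auto simp: M_def card_image)
  ultimately show ?thesis by (simp add: rmax_def M_def)
qed

text \<open>For \<open>a < b\<close>, the first letter \<open>b - 1\<close> of the subword can only
  be matched by the maximum \<open>m\<close>, so the others must be found in \<open>R\<close>, and
  \<open>stack_sort w\<close> ends in \<open>stack_sort R\<close> followed by \<open>m\<close>. The
  bound by \<open>rmax\<close> keeps the suffix from reaching back into \<open>stack_sort L\<close>.
  The bound \<open>b\<close> is arbitrary so that the induction can pass to \<open>R\<close> with
  \<open>b - 1\<close>.\<close>

lemma subseq_top_iff:
  assumes "distinct w" "\<forall>x\<in>set w. x < b"
  shows "subseq (rev [a..<b]) w \<longleftrightarrow> b - a \<le> rmax w \<and> suffix [a..<b] (stack_sort w)"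
  using assms
proof (induction w arbitrary: b rule: distinct_max_induct)
  case Nil
  have "subseq (rev [a..<b]) [] \<longleftrightarrow> b \<le> a"
    by (auto dest: list_emb_Nil2)
  \<comment> \<open>The length bound gives \<open>rmax [] = 0\<close>, and both sides become
    \<open>b \<le> a\<close>.\<close>
  then show ?case using rmax_le_length[of "[]"] by (auto simp: stack_sort_Nil)
next
  case (append_max L m R)
  note S = stack_sort_append_max[OF append_max.hyps(4)]
  show ?case
  proof (cases "a < b")
    case False
    then show ?thesis by simp
  next
    case True
    then obtain b' where b: "b = Suc b'" "a \<le> b'" by (cases b) auto
    show ?thesis
    proof (cases "m = b'")
      case False
      then have "m < b'" using append_max.prems b by auto
      then have "b' \<notin> set (L @ m # R)" using append_max.hyps(4) by (auto dest: less_trans)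
      moreover have "b' \<in> set (rev [a..<b])" using b by simp
      ultimately have "\<not> subseq (rev [a..<b]) (L @ m # R)"
        by (blast elim: list_emb_set)
      moreover have "\<not> suffix [a..<b] (stack_sort (L @ m # R))"
        using False b by (auto simp: S suffix_def simp flip: append_assoc)
      ultimately show ?thesis by blast
    next
      case True
      have R: "\<forall>x\<in>set R. x < b'" and "b' \<notin> set L" using append_max.hyps(4) True by auto
      \<comment> \<open>The word sought starts with \<open>b'\<close>, which does not occur in
        \<open>L\<close>; hence \<open>L\<close> is skipped and \<open>b'\<close> is matched by
        \<open>m\<close>.\<close>
      then have "subseq (rev [a..<b]) (L @ m # R) \<longleftrightarrow> subseq (rev [a..<b']) R"
        using b True by (induction L) auto
      also have "\<dots> \<longleftrightarrow> b' - a \<le> rmax R \<and> suffix [a..<b'] (stack_sort R)"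
        using append_max.IH(2)[OF R] .
      also have "\<dots> \<longleftrightarrow> b' - a \<le> rmax R \<and> suffix [a..<b'] (stack_sort L @ stack_sort R)"
      proof (rule conj_cong[OF refl])
        \<comment> \<open>Since \<open>rmax R\<close> is at most the length of \<open>R\<close>, the
          suffix is short enough to lie within \<open>stack_sort R\<close>.\<close>
        assume "b' - a \<le> rmax R"
        then have "length [a..<b'] \<le> length (stack_sort R)"
          using rmax_le_length[of R] append_max.hyps(2) by (simp add: length_stack_sort)
        then show "suffix [a..<b'] (stack_sort R) \<longleftrightarrow> suffix [a..<b'] (stack_sort L @ stack_sort R)"
          by (metis suffix_appendI suffix_length_suffix suffix_def)
      qed
      also have "\<dots> \<longleftrightarrow> b - a \<le> rmax (L @ m # R) \<and> suffix [a..<b] (stack_sort (L @ m # R))"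
      proof -
        have "stack_sort (L @ m # R) = (stack_sort L @ stack_sort R) @ [b']"
          using S True by simp
        then have "suffix [a..<b] (stack_sort (L @ m # R)) \<longleftrightarrow>
            suffix [a..<b'] (stack_sort L @ stack_sort R)"
          using b by (simp only: upt_Suc if_True snoc_suffix_snoc simp_thms)
        then show ?thesis
          using b rmax_append_max[OF append_max.hyps(4)] by (simp only: Suc_diff_le Suc_le_mono)
      qed
      finally show ?thesis .
    qed
  qed
qed

text \<open>To dominate position 0 is to be a left-to-right maximum. Once the letters above
  \<open>x\<close> end the word in increasing order, the rest is a permutation of
  \<open>1..x\<close>, whose last letter is \<open>x\<close> iff it exceeds all letters before
  it.\<close>

lemma suffix_top_iff:
  assumes "w \<in> perms n" "k \<le> n"
  shows "suffix [n + 1 - k..<n + 1] w \<longleftrightarrow> (\<forall>j\<in>{n - k..<n}. dominates w j 0)"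
  using assms(2)
proof (induction k)
  case 0
  show ?case by simp
next
  case (Suc k)
  have len: "length w = n" using assms(1) by (rule perms_length)
  \<comment> \<open>\<open>x\<close> is the letter by which the suffix grows; its 0-based position
    in the word has to be \<open>x - 1\<close>.\<close>
  define x where "x = n - k"
  have x: "n + 1 - Suc k = x" "n + 1 - k = Suc x" "n - Suc k = x - 1" "n - k = x" "1 \<le> x" "x \<le> n"
    using Suc.prems by (auto simp: x_def)
  have upt: "[x..<n + 1] = x # [Suc x..<n + 1]" using x by (simp add: upt_conv_Cons)
  have ivl: "{x - 1..<n} = insert (x - 1) {x..<n}" using x by auto
  have IH: "suffix [Suc x..<n + 1] w \<longleftrightarrow> (\<forall>j\<in>{x..<n}. dominates w j 0)"
    using Suc.IH Suc.prems unfolding x(2,4) by simp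
  show ?case
  proof (cases "suffix [Suc x..<n + 1] w")
    case False
    then have "\<not> suffix (x # [Suc x..<n + 1]) w" by (metis suffix_ConsD)
    then show ?thesis using False IH unfolding x(1,3) upt ivl by blast
  next
    case True
    then obtain A where A: "w = A @ [Suc x..<n + 1]" by (auto simp: suffix_def)
    have lenA: "length A = x" using A len x by (simp del: upt_Suc)
    have setA: "set A = {1..x}"
    proof -
      have "set A \<inter> {Suc x..<n + 1} = {}" "set A \<union> {Suc x..<n + 1} = {1..n}"
        using assms(1) unfolding A permutations_of_set_iff distinct_append set_append set_upt
        by blast+
      then have "set A = {1..n} - {Suc x..<n + 1}" by blast
      also have "\<dots> = {1..x}" using x by auto
      finally show ?thesis .
    qed
    obtain B y where B: "A = B @ [y]" using lenA x(5) by (cases A rule: rev_cases) auto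
    have lenB: "length B = x - 1" using B lenA by simp
    have "distinct A" using A assms(1) by (simp add: permutations_of_set_iff)
    have "suffix (x # [Suc x..<n + 1]) w \<longleftrightarrow> y = x"
      unfolding A B by (auto simp: suffix_def)
    also have "\<dots> \<longleftrightarrow> dominates w (x - 1) 0"
    proof
      assume "y = x"
      have "z < x" if "z \<in> set B" for z
      proof -
        have "z \<in> {1..x}" using that setA B by auto
        moreover have "z \<noteq> x" using that \<open>distinct A\<close> B \<open>y = x\<close> by auto
        ultimately show ?thesis by auto
      qed
      then show "dominates w (x - 1) 0"
        using lenB \<open>y = x\<close> by (auto simp: dominates_def A B nth_append)
    next
      assume d: "dominates w (x - 1) 0"
      have "x \<in> set A" using setA x by simp
      moreover have "z < y" if z: "z \<in> set B" for z
      proof -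
        obtain i where i: "i < length B" "z = B ! i" using z by (metis in_set_conv_nth)
        have "w ! i < w ! (x - 1)"
          by (rule d[unfolded dominates_def, rule_format]) (use i lenB in auto)
        then show ?thesis using i lenB by (simp add: A B nth_append)
      qed
      moreover have "y \<le> x" using setA B by auto
      ultimately show "y = x" using B by fastforce
    qed
    finally show ?thesis using True IH unfolding x(1,3) upt ivl by blast
  qed
qed

lemma stack_sort_perms: "w \<in> perms n \<Longrightarrow> stack_sort w \<in> perms n"
  by (simp add: permutations_of_set_iff set_stack_sort distinct_stack_sort)

text \<open>The shape of \<open>u\<close> supplies \<open>rmax\<close>, and the shape of
  \<open>stack_sort u\<close> supplies the final left-to-right maxima.\<close>

lemma same_shape_zeil:
  assumes u: "u \<in> perms n" and v: "v \<in> perms n"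
    and shape: "same_shape u v" "same_shape (stack_sort u) (stack_sort v)"
  shows "zeil u = zeil v"
proof -
  have "subseq (rev [n + 1 - k..<n + 1]) u \<longleftrightarrow> subseq (rev [n + 1 - k..<n + 1]) v"
    if k: "k \<le> n" for k
  proof -
    have *: "subseq (rev [n + 1 - k..<n + 1]) w \<longleftrightarrow>
        k \<le> rmax w \<and> (\<forall>j\<in>{n - k..<n}. dominates (stack_sort w) j 0)"
      if "w \<in> perms n" for w
      using that k subseq_top_iff[of w "n + 1" "n + 1 - k"]
        suffix_top_iff[OF stack_sort_perms[OF that] k]
      by (auto simp: permutations_of_set_iff simp del: upt_Suc)
    have "dominates (stack_sort u) j 0 \<longleftrightarrow> dominates (stack_sort v) j 0" if "j \<in> {n - k..<n}" for j
    proof -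
      have "j < length (stack_sort u)" "0 < length (stack_sort u)"
        using perms_length[OF stack_sort_perms[OF u]] that by auto
      then show ?thesis using shape(2) unfolding same_shape_def by blast
    qed
    then show ?thesis
      unfolding *[OF u] *[OF v] same_shape_rmax[OF shape(1)] by auto
  qed
  then show ?thesis
    unfolding zeil_def perms_length[OF u] perms_length[OF v]
    by (intro arg_cong[where f = Max] Collect_cong conj_cong refl) simp
qed

section \<open>Matching the two sets by pairs of shapes\<close>

lemma same_shape_stats:
  assumes "u \<in> perms n" "v \<in> perms n"
    and "same_shape u v" "same_shape (stack_sort u) (stack_sort v)"
  shows "stats u = stats v"
  using assms
  by (simp add: stats_def des_def maj_def same_shape_descents[of u v] same_shape_rmax[of u v]
      same_shape_lmax[of u v] same_shape_valley[of u v] same_shape_peak[of u v]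
      same_shape_ddes[of u v] same_shape_dasc[of u v] same_shape_zeil[of u n v]
      same_shape_indmax[of u v n] same_shape_slmax[of u v n] same_shape_rir[of u v]
      same_shape_rdr[of u v] same_shape_lir[of u v] same_shape_ldr[of u v])

text \<open>Two lifts are combined: the shape of \<open>g (stack_sort u)\<close> contains a word
  \<open>p\<close> that sorts to the identity; then \<open>g p\<close> has the shape of
  \<open>stack_sort u\<close>, as \<open>g\<close> is an involution respecting shapes, and it lifts
  to a word \<open>v\<close> with the shape of \<open>u\<close>.\<close>

lemma stack_sort_partner:
  assumes f: "f = id \<or> f = rev" and g: "g = id \<or> g = rev"
    and u: "u \<in> perms n" "stack_sort (f (stack_sort u)) = [1..<n + 1]"
  shows "\<exists>v\<in>perms n. stack_sort (g (stack_sort v)) = [1..<n + 1] \<and>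
    same_shape u v \<and> same_shape (stack_sort u) (stack_sort v)"
proof -
  have gg: "g (g x) = x" and mset_g: "mset (g x) = mset x" and len_g: "length (g x) = length x"
    and dist_g: "distinct (g x) = distinct x"
    and shape_g: "same_shape x y \<Longrightarrow> same_shape (g x) (g y)" for x y :: "nat list"
    using g same_shape_rev by auto
  note Su = stack_sort_perms[OF u(1)]
  have d: "distinct u" "distinct (stack_sort u)" "distinct (g (stack_sort u))"
    using u(1) Su dist_g by (auto simp: permutations_of_set_iff)
  have len: "length (stack_sort u) = length u" using d(1) by (rule length_stack_sort)
  \<comment> \<open>In an increasing word each position dominates all earlier ones, so the identity
    can be lifted along any shape.\<close>
  have "dominates [1..<n + 1] j i" if "i < j" "j < length (g (stack_sort u))" for i j
    using that perms_length[OF Su] by (auto simp: dominates_def len_g nth_upt simp del: upt_Suc)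
  then obtain p where p: "same_shape (g (stack_sort u)) p" "mset p = mset [1..<n + 1]"
      "stack_sort p = [1..<n + 1]"
    using stack_sort_lift[OF d(3), of "[1..<n + 1]"] perms_length[OF Su] len_g
    by (auto simp del: upt_Suc)
  have shape_p: "same_shape (stack_sort u) (g p)" using shape_g[OF p(1)] gg by simp
  then obtain v where v: "same_shape u v" "mset v = mset (g p)" "stack_sort v = g p"
    using stack_sort_lift[OF d(1), of "g p"] len by (auto simp: same_shape_def)
  have "mset v = mset [1..<n + 1]" using v(2) mset_g p(2) by simp
  then have "v \<in> perms n"
    unfolding permutations_of_set_iff
    by (metis mset_eq_imp_distinct_iff distinct_upt mset_eq_setD set_upt atLeastLessThanSuc_atLeastAtMost Suc_eq_plus1)
  moreover have "stack_sort (g (stack_sort v)) = [1..<n + 1]"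
    by (simp only: v(3) gg p(3))
  moreover have "same_shape (stack_sort u) (stack_sort v)"
    using shape_p by (simp only: v(3))
  ultimately show ?thesis using v(1) by blast
qed

text \<open>Injectivity on a shape is applied to the outer sort first, then, after undoing
  \<open>f\<close>, to the inner one.\<close>

lemma stack_sort_partner_unique:
  assumes f: "f = id \<or> f = rev"
    and u: "u \<in> perms n" "stack_sort (f (stack_sort u)) = [1..<n + 1]"
    and v: "v \<in> perms n" "stack_sort (f (stack_sort v)) = [1..<n + 1]"
    and shape: "same_shape u v" "same_shape (stack_sort u) (stack_sort v)"
  shows "u = v"
proof -
  have ff: "f (f x) = x" and dist_f: "distinct (f x) = distinct x"
    and shape_f: "same_shape x y \<Longrightarrow> same_shape (f x) (f y)" for x y :: "nat list"
    using f same_shape_rev by auto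
  have d: "distinct u" "distinct v" "distinct (f (stack_sort u))" "distinct (f (stack_sort v))"
    using u v stack_sort_perms dist_f by (auto simp: permutations_of_set_iff distinct_stack_sort)
  have "f (stack_sort u) = f (stack_sort v)"
    using same_shape_stack_sort_inj[OF d(3,4) shape_f[OF shape(2)]] u(2) v(2) by simp
  then have "stack_sort u = stack_sort v" by (metis ff)
  then show ?thesis using same_shape_stack_sort_inj d shape(1) by blast
qed

text \<open>Exchanging \<open>id\<close> and \<open>rev\<close> for \<open>f\<close> and
  \<open>g\<close> gives both inequalities. The predicate \<open>P\<close> covers the total count as
  well as the count for each value of \<open>stats\<close>.\<close>

lemma card_stats_le:
  assumes f: "f = id \<or> f = rev" and g: "g = id \<or> g = rev"
  shows "card {\<sigma> \<in> perms n. stack_sort (f (stack_sort \<sigma>)) = [1..<n + 1] \<and> P (stats \<sigma>)} \<le>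
    card {\<sigma> \<in> perms n. stack_sort (g (stack_sort \<sigma>)) = [1..<n + 1] \<and> P (stats \<sigma>)}"
    (is "card ?A \<le> card ?B")
proof (rule card_le_if_inj_on_rel[where
      r = "\<lambda>u v. same_shape u v \<and> same_shape (stack_sort u) (stack_sort v)"])
  fix u assume "u \<in> ?A"
  then have u: "u \<in> perms n" "stack_sort (f (stack_sort u)) = [1..<n + 1]" "P (stats u)" by blast+
  obtain v where v: "v \<in> perms n" "stack_sort (g (stack_sort v)) = [1..<n + 1]"
      "same_shape u v" "same_shape (stack_sort u) (stack_sort v)"
    using stack_sort_partner[OF f g u(1,2)] by blast
  have "P (stats v)" using same_shape_stats[OF u(1) v(1,3,4)] u(3) by simp
  with v show "\<exists>v. v \<in> ?B \<and> same_shape u v \<and> same_shape (stack_sort u) (stack_sort v)" by blast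
next
  fix u v w
  assume "u \<in> ?A" "v \<in> ?A"
    and uw: "same_shape u w \<and> same_shape (stack_sort u) (stack_sort w)"
    and vw: "same_shape v w \<and> same_shape (stack_sort v) (stack_sort w)"
  \<comment> \<open>Two words sharing a partner have equal pairs of shapes.\<close>
  have "same_shape u v" "same_shape (stack_sort u) (stack_sort v)"
    using same_shape_trans same_shape_sym uw vw by blast+
  with \<open>u \<in> ?A\<close> \<open>v \<in> ?A\<close> show "u = v"
    using stack_sort_partner_unique[OF f] by blast
qed simp

theorem theorem1p2:
  fixes n :: nat
  assumes "n \<ge> 1"
  shows "card (sorted_by_SS n) = card (sorted_by_SrS n) \<and>
    (\<forall>v. card {\<sigma> \<in> sorted_by_SS n. stats \<sigma> = v} = card {\<sigma> \<in> sorted_by_SrS n. stats \<sigma> = v})"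
proof -
  have *: "card {\<sigma> \<in> sorted_by_SS n. P (stats \<sigma>)} = card {\<sigma> \<in> sorted_by_SrS n. P (stats \<sigma>)}" for P
    using card_stats_le[of id rev n P] card_stats_le[of rev id n P]
    by (simp add: sorted_by_SS_def sorted_by_SrS_def conj_assoc)
  show ?thesis
  proof (intro conjI allI)
    show "card (sorted_by_SS n) = card (sorted_by_SrS n)" using *[of "\<lambda>_. True"] by simp
  qed (rule *)
qed

end
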